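(* Let $(X,d)$ be an Hadamard space with linear dual space $X^{\lozenge}$ and let $M\subseteq X\times X^{\lozenge}$ be a maximal monotone set. Then: (i) for each $u\in X$, the set $M^{\lozenge}_u:=\{u^{\lozenge}\in X^{\lozenge} : (u,u^{\lozenge})\in M\}$ is a closed and convex subset of $(X^{\lozenge},\|\cdot\|_{\lozenge})$; (ii) $M$ is sequentially $bw\times\|\cdot\|_{\lozenge}$-closed in $X\times X^{\lozenge}$ (and hence $d\times\|\cdot\|_{\lozenge}$-closed, i.e. closed in the product of the metric topology of $X$ and the norm topology of $X^{\lozenge}$); (iii) if $\mathrm{Dom}(M):=\{x\in X:\exists\, x^{\lozenge}\in X^{\lozenge},\ (x,x^{\lozenge})\in M\}$ is bounded in $X$, then $M$ is sequentially weakly$\times\|\cdot\|_{\lozenge}$-closed in $X\times X^{\lozenge}$.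
   Context: An Hadamard space is a complete $\mathrm{CAT}(0)$ space $(X,d)$. For $a,b\in X$ write $\overrightarrow{ab}$ for the ordered pair $(a,b)\in X^2$. The quasilinearization is $\langle\overrightarrow{ab},\overrightarrow{cd}\rangle:=\frac12\big(d(a,d)^2+d(b,c)^2-d(a,c)^2-d(b,d)^2\big)$. The dual space $X^*$ is the set of equivalence classes $[t\overrightarrow{ab}]$ of triples $(t,a,b)\in\mathbb{R}\times X^2$, where $(t,a,b)\sim(s,c,d)$ iff $t\langle\overrightarrow{ab},\overrightarrow{xy}\rangle=s\langle\overrightarrow{cd},\overrightarrow{xy}\rangle$ for all $x,y\in X$; it acts on $X^2$ by $\langle[t\overrightarrow{ab}],\overrightarrow{xy}\rangle=t\langle\overrightarrow{ab},\overrightarrow{xy}\rangle$. The linear dual space $X^{\lozenge}=\mathrm{span}\,X^*$ is the vector space of finite linear combinations $\sum_i\alpha_ix_i^*$ ($\alpha_i\in\mathbb{R}$, $x_i^*\in X^*$), identified with the functions they define on $X^2$ by $\langle\sum_i\alpha_ix_i^*,\overrightarrow{xy}\rangle=\sum_i\alpha_i\langle x_i^*,\overrightarrow{xy}\rangle$. It carries the norm $\|x^{\lozenge}\|_{\lozenge}=\sup\Big\{\frac{|\langle x^{\lozenge},\overrightarrow{ab}\rangle-\langle x^{\lozenge},\overrightarrow{cd}\rangle|}{d(a,b)+d(c,d)}: a,b,c,d\in X,\ (a,c)\ne(b,d)\Big\}$. Elements $(x,x^{\lozenge}),(y,y^{\lozenge})\in X\times X^{\lozenge}$ are monotonically related if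 $\langle x^{\lozenge}-y^{\lozenge},\overrightarrow{yx}\rangle\ge 0$. A set $M\subseteq X\times X^{\lozenge}$ is monotone if any two of its elements are monotonically related; a monotone set is maximal if no monotone set properly contains it. A sequence $\{x_n\}$ in $X$ converges weakly to $x\in X$ if $\lim_n\langle\overrightarrow{xx_n},\overrightarrow{xy}\rangle=0$ for all $y\in X$; it is $bw$-convergent to $x$ if it is bounded and converges weakly to $x$. A sequence $(x_n,x_n^{\lozenge})$ is $bw\times\|\cdot\|_{\lozenge}$-convergent (resp. weakly$\times\|\cdot\|_{\lozenge}$-convergent) to $(x,x^{\lozenge})$ if $x_n$ is $bw$-convergent (resp. weakly convergent) to $x$ and $\|x_n^{\lozenge}-x^{\lozenge}\|_{\lozenge}\to0$. A subset of $X\times X^{\lozenge}$ is sequentially closed for one of these modes of convergence if it contains the limit of every sequence of its elements that converges in that mode. *)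

theory Defs
  imports "HOL-Analysis.Analysis"
begin

section \<open>Hadamard spaces\<close>

text \<open>
  A geodesic from \<open>x\<close> to \<open>y\<close> is an isometric embedding of \<open>[0, l]\<close> joining the two points;
  necessarily \<open>l = dist x y\<close>.
\<close>

definition geodesic_segment :: "'a::metric_space set \<Rightarrow> 'a \<Rightarrow> 'a \<Rightarrow> bool" where
  "geodesic_segment S x y \<longleftrightarrow>
     (\<exists>\<gamma>::real \<Rightarrow> 'a. \<gamma> 0 = x \<and> \<gamma> (dist x y) = y \<and>
        (\<forall>s\<in>{0..dist x y}. \<forall>t\<in>{0..dist x y}. dist (\<gamma> s) (\<gamma> t) = \<bar>s - t\<bar>) \<and>
        S = \<gamma> ` {0..dist x y})"

text \<open>
  \<open>x'\<close> is the comparison point of \<open>x\<close>, where \<open>S\<close> is a geodesic segment starting at \<open>p\<close> and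
  \<open>[p', q']\<close> is the corresponding side of a comparison triangle.
\<close>

definition comparison_point ::
    "'a::metric_space set \<Rightarrow> 'a \<Rightarrow> real^2 \<Rightarrow> real^2 \<Rightarrow> 'a \<Rightarrow> real^2 \<Rightarrow> bool" where
  "comparison_point S p p' q' x x' \<longleftrightarrow>
     x \<in> S \<and> x' \<in> closed_segment p' q' \<and> dist p' x' = dist p x"

text \<open>
  CAT(0) spaces: geodesic spaces in which every geodesic triangle is at least as thin as its
  comparison triangle in the Euclidean plane.
\<close>

class cat0_space = metric_space +
  assumes geodesic_segment_exists: "\<exists>S. geodesic_segment S x y"
    and cat0_comparison:
      "\<lbrakk> geodesic_segment S1 p q; geodesic_segment S2 q r; geodesic_segment S3 r p;
         dist p' q' = dist p q; dist q' r' = dist q r; dist r' p' = dist r p;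
         comparison_point S1 p p' q' x x' \<or> comparison_point S2 q q' r' x x' \<or>
           comparison_point S3 r r' p' x x';
         comparison_point S1 p p' q' y y' \<or> comparison_point S2 q q' r' y y' \<or>
           comparison_point S3 r r' p' y y' \<rbrakk>
       \<Longrightarrow> dist x y \<le> dist x' y'"

class hadamard_space = cat0_space + complete_space

section \<open>Quasilinearization and the dual space\<close>

definition quasilin :: "'a::metric_space \<Rightarrow> 'a \<Rightarrow> 'a \<Rightarrow> 'a \<Rightarrow> real" where
  "quasilin a b c d =
     1/2 * ((dist a d)\<^sup>2 + (dist b c)\<^sup>2 - (dist a c)\<^sup>2 - (dist b d)\<^sup>2)"

definition dual_equiv ::
    "real \<times> 'a::metric_space \<times> 'a \<Rightarrow> real \<times> 'a \<times> 'a \<Rightarrow> bool" where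
  "dual_equiv = (\<lambda>(t, a, b) (s, c, d).
     \<forall>x y. t * quasilin a b x y = s * quasilin c d x y)"

quotient_type (overloaded) 'a dual_space = "real \<times> ('a::metric_space) \<times> 'a" / dual_equiv
  by (rule equivpI) (auto simp: reflp_def symp_def transp_def dual_equiv_def)

lift_definition dual_act :: "'a::metric_space dual_space \<Rightarrow> 'a \<Rightarrow> 'a \<Rightarrow> real"
  is "\<lambda>(t, a, b) x y. t * quasilin a b x y"
  by (auto simp: dual_equiv_def fun_eq_iff)

section \<open>The linear dual space\<close>

text \<open>Finite linear combinations of dual elements, as functions of two points.\<close>

typedef (overloaded) 'a linear_dual =
  "{f :: 'a::metric_space \<Rightarrow> 'a \<Rightarrow> real.
      \<exists>T \<alpha>. finite T \<and> f = (\<lambda>x y. \<Sum>s\<in>T. \<alpha> s * dual_act s x y)}"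
  morphisms pairing Abs_linear_dual
  by (rule exI[of _ "\<lambda>x y. 0"], rule CollectI, rule exI[of _ "{}"]) simp

setup_lifting type_definition_linear_dual

lemma pairing_eqI: "(\<And>x y. pairing f x y = pairing g x y) \<Longrightarrow> f = g"
  by (rule pairing_inject[THEN iffD1]) (intro ext)

lemma pairing_exists: "\<exists>T \<alpha>. finite T \<and> (\<forall>x y. pairing f x y = (\<Sum>s\<in>T. \<alpha> s * dual_act s x y))"
proof -
  obtain T \<alpha> where "finite T" "pairing f = (\<lambda>x y. \<Sum>s\<in>T. \<alpha> s * dual_act s x y)"
    using pairing[of f] by blast
  then show ?thesis by (intro exI[of _ T] exI[of _ \<alpha>]) simp
qed

instantiation linear_dual :: (metric_space) real_vector
begin

lift_definition zero_linear_dual :: "'a linear_dual" is "\<lambda>x y. 0"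
  by (rule exI[of _ "{}"]) simp

lift_definition plus_linear_dual :: "'a linear_dual \<Rightarrow> 'a linear_dual \<Rightarrow> 'a linear_dual"
  is "\<lambda>f g x y. f x y + g x y"
proof -
  fix f g :: "'a \<Rightarrow> 'a \<Rightarrow> real"
  assume "\<exists>T \<alpha>. finite T \<and> f = (\<lambda>x y. \<Sum>s\<in>T. \<alpha> s * dual_act s x y)"
    and "\<exists>T \<alpha>. finite T \<and> g = (\<lambda>x y. \<Sum>s\<in>T. \<alpha> s * dual_act s x y)"
  then obtain T \<alpha> U \<beta> where T: "finite T" and f: "f = (\<lambda>x y. \<Sum>s\<in>T. \<alpha> s * dual_act s x y)"
    and U: "finite U" and g: "g = (\<lambda>x y. \<Sum>s\<in>U. \<beta> s * dual_act s x y)"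
    by blast
  define \<gamma> where "\<gamma> s = (if s \<in> T then \<alpha> s else 0) + (if s \<in> U then \<beta> s else 0)" for s
  have "f x y + g x y = (\<Sum>s\<in>T \<union> U. \<gamma> s * dual_act s x y)" for x y
  proof -
    have "f x y = (\<Sum>s\<in>T \<union> U. (if s \<in> T then \<alpha> s else 0) * dual_act s x y)"
      unfolding f using T U by (intro sum.mono_neutral_cong_left) auto
    moreover have "g x y = (\<Sum>s\<in>T \<union> U. (if s \<in> U then \<beta> s else 0) * dual_act s x y)"
      unfolding g using T U by (intro sum.mono_neutral_cong_left) auto
    ultimately show ?thesis
      unfolding \<gamma>_def by (simp add: sum.distrib distrib_right)
  qed
  then show "\<exists>T \<alpha>. finite T \<and> (\<lambda>x y. f x y + g x y) = (\<lambda>x y. \<Sum>s\<in>T. \<alpha> s * dual_act s x y)"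
    using T U by (intro exI[of _ "T \<union> U"] exI[of _ \<gamma>]) auto
qed

lift_definition scaleR_linear_dual :: "real \<Rightarrow> 'a linear_dual \<Rightarrow> 'a linear_dual"
  is "\<lambda>r f x y. r * f x y"
proof -
  fix r :: real and f :: "'a \<Rightarrow> 'a \<Rightarrow> real"
  assume "\<exists>T \<alpha>. finite T \<and> f = (\<lambda>x y. \<Sum>s\<in>T. \<alpha> s * dual_act s x y)"
  then obtain T \<alpha> where "finite T" "f = (\<lambda>x y. \<Sum>s\<in>T. \<alpha> s * dual_act s x y)"
    by blast
  then show "\<exists>T \<alpha>. finite T \<and> (\<lambda>x y. r * f x y) = (\<lambda>x y. \<Sum>s\<in>T. \<alpha> s * dual_act s x y)"
    by (intro exI[of _ T] exI[of _ "\<lambda>s. r * \<alpha> s"]) (auto simp: sum_distrib_left mult.assoc)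
qed

definition uminus_linear_dual :: "'a linear_dual \<Rightarrow> 'a linear_dual" where
  "uminus_linear_dual f = (-1) *\<^sub>R f"

definition minus_linear_dual :: "'a linear_dual \<Rightarrow> 'a linear_dual \<Rightarrow> 'a linear_dual" where
  "minus_linear_dual f g = f + (- g)"

instance
proof
  note reps = zero_linear_dual.rep_eq plus_linear_dual.rep_eq scaleR_linear_dual.rep_eq
  fix f g h :: "'a linear_dual" and r s :: real
  show "f + g + h = f + (g + h)" by (rule pairing_eqI) (simp add: reps)
  show "f + g = g + f" by (rule pairing_eqI) (simp add: reps)
  show "0 + f = f" by (rule pairing_eqI) (simp add: reps)
  show "- f + f = 0" by (rule pairing_eqI) (simp add: reps uminus_linear_dual_def)
  show "f - g = f + - g" by (rule minus_linear_dual_def)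
  show "r *\<^sub>R (f + g) = r *\<^sub>R f + r *\<^sub>R g"
    by (rule pairing_eqI) (simp add: reps distrib_left)
  show "(r + s) *\<^sub>R f = r *\<^sub>R f + s *\<^sub>R f"
    by (rule pairing_eqI) (simp add: reps distrib_right)
  show "r *\<^sub>R s *\<^sub>R f = (r * s) *\<^sub>R f" by (rule pairing_eqI) (simp add: reps)
  show "1 *\<^sub>R f = f" by (rule pairing_eqI) (simp add: reps)
qed

end

lemma pairing_simps [simp]:
  "pairing 0 x y = 0"
  "pairing (f + g) x y = pairing f x y + pairing g x y"
  "pairing (r *\<^sub>R f) x y = r * pairing f x y"
  "pairing (- f) x y = - pairing f x y"
  "pairing (f - g) x y = pairing f x y - pairing g x y"
  unfolding minus_linear_dual_def uminus_linear_dual_def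
  by (simp_all only: zero_linear_dual.rep_eq plus_linear_dual.rep_eq scaleR_linear_dual.rep_eq)

section \<open>The Cauchy-Schwarz inequality in CAT(0) spaces\<close>

text \<open>It makes the supremum defining the norm of the linear dual space finite.\<close>

lemma comparison_triangle_exists:
  fixes p q r :: "'a::metric_space"
  shows "\<exists>p' q' r' :: real^2. dist p' q' = dist p q \<and> dist q' r' = dist q r \<and> dist r' p' = dist r p"
proof -
  have dist2: "dist (vector [x1, x2] :: real^2) (vector [y1, y2]) = sqrt ((x1 - y1)\<^sup>2 + (x2 - y2)\<^sup>2)"
    for x1 x2 y1 y2 :: real
    by (simp add: dist_vec_def L2_set_def sum_2 dist_real_def)
  define c b e where "c = dist p q" and "b = dist r p" and "e = dist q r"
  have nn: "c \<ge> 0" "b \<ge> 0" "e \<ge> 0" by (auto simp: c_def b_def e_def)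
  have tri: "c \<le> b + e" "b \<le> c + e" "e \<le> b + c"
    unfolding c_def b_def e_def
    by (metis add.commute dist_commute dist_triangle)+
  show ?thesis
  proof (cases "c = 0")
    case True
    then have "b = e" using tri by auto
    then show ?thesis using True nn
      unfolding c_def[symmetric] b_def[symmetric] e_def[symmetric]
      by (intro exI[of _ "vector [0, 0]"] exI[of _ "vector [b, 0]"])
        (simp add: dist2)
  next
    case False
    then have cpos: "c > 0" using nn by simp
    define u where "u = (b\<^sup>2 + c\<^sup>2 - e\<^sup>2) / (2 * c)"
    have uc: "2 * c * u = b\<^sup>2 + c\<^sup>2 - e\<^sup>2" using cpos by (simp add: u_def)
    have "(c - b)\<^sup>2 \<le> e\<^sup>2"
      using tri by (intro abs_le_square_iff[THEN iffD1]) auto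
    then have "2 * c * u \<le> 2 * c * b"
      unfolding uc by (simp add: power2_eq_square algebra_simps)
    then have u1: "u \<le> b" using cpos by simp
    have "e\<^sup>2 \<le> (b + c)\<^sup>2" using tri nn by (intro power_mono) auto
    then have "2 * c * (- b) \<le> 2 * c * u"
      unfolding uc by (simp add: power2_eq_square algebra_simps)
    then have u2: "- b \<le> u" using cpos by (simp only: mult_le_cancel_left_pos) 
    have ub: "u\<^sup>2 \<le> b\<^sup>2" using u1 u2 nn by (intro abs_le_square_iff[THEN iffD1]) auto
    define v where "v = sqrt (b\<^sup>2 - u\<^sup>2)"
    have v2: "v\<^sup>2 = b\<^sup>2 - u\<^sup>2" unfolding v_def using ub by simp
    have "dist (vector [0, 0] :: real^2) (vector [c, 0]) = c"
      using nn by (simp add: dist2)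
    moreover have "dist (vector [u, v] :: real^2) (vector [0, 0]) = b"
      using nn by (simp add: dist2 v2)
    moreover have "(c - u)\<^sup>2 + v\<^sup>2 = e\<^sup>2"
      using uc by (simp add: v2) (simp add: power2_eq_square algebra_simps)
    then have "dist (vector [c, 0] :: real^2) (vector [u, v]) = e"
      using nn by (simp add: dist2)
    ultimately show ?thesis
      unfolding c_def[symmetric] b_def[symmetric] e_def[symmetric] by blast
  qed
qed

lemma cat0_convexity:
  fixes a b :: "'a::cat0_space" and l :: real
  assumes l: "0 \<le> l" "l \<le> 1"
  shows "\<exists>z. \<forall>p. (dist p z)\<^sup>2 \<le>
    (1 - l) * (dist p a)\<^sup>2 + l * (dist p b)\<^sup>2 - l * (1 - l) * (dist a b)\<^sup>2"
proof -
  obtain S where S: "geodesic_segment S a b" using geodesic_segment_exists by blast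
  then obtain \<gamma> where \<gamma>: "\<gamma> 0 = a" "\<gamma> (dist a b) = b"
    "\<forall>s\<in>{0..dist a b}. \<forall>t\<in>{0..dist a b}. dist (\<gamma> s) (\<gamma> t) = \<bar>s - t\<bar>"
    "S = \<gamma> ` {0..dist a b}"
    unfolding geodesic_segment_def by blast
  define z where "z = \<gamma> (l * dist a b)"
  have lin: "l * dist a b \<in> {0..dist a b}"
    using l by (auto simp: mult_left_le_one_le)
  then have zS: "z \<in> S" using \<gamma>(4) by (auto simp: z_def)
  have az: "dist a z = l * dist a b"
  proof -
    have "dist (\<gamma> 0) (\<gamma> (l * dist a b)) = \<bar>0 - l * dist a b\<bar>"
      using \<gamma>(3) lin by (metis atLeastAtMost_iff order_refl zero_le_dist)
    then show ?thesis using l by (simp add: z_def \<gamma>(1))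
  qed
  have "(dist p z)\<^sup>2 \<le>
    (1 - l) * (dist p a)\<^sup>2 + l * (dist p b)\<^sup>2 - l * (1 - l) * (dist a b)\<^sup>2" for p
  proof -
    obtain S2 where S2: "geodesic_segment S2 b p" using geodesic_segment_exists by blast
    obtain S3 where S3: "geodesic_segment S3 p a" using geodesic_segment_exists by blast
    obtain a' b' p' :: "real^2" where
      tr: "dist a' b' = dist a b" "dist b' p' = dist b p" "dist p' a' = dist p a"
      using comparison_triangle_exists by blast
    define z' where "z' = (1 - l) *\<^sub>R a' + l *\<^sub>R b'"
    have "a' - z' = l *\<^sub>R (a' - b')" by (simp add: z'_def algebra_simps)
    then have "dist a' z' = l * dist a' b'" using l by (simp add: dist_norm)
    moreover have "z' \<in> closed_segment a' b'"
      unfolding closed_segment_def z'_def using l by auto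
    ultimately have cz: "comparison_point S a a' b' z z'"
      using zS az tr by (simp add: comparison_point_def)
    have "p \<in> S3" using S3 unfolding geodesic_segment_def by force
    then have cp: "comparison_point S3 p p' a' p p'" by (simp add: comparison_point_def)
    have "dist p z \<le> dist p' z'"
      using cat0_comparison[OF S S2 S3 tr] cz cp by blast
    then have "(dist p z)\<^sup>2 \<le> (dist p' z')\<^sup>2" by (intro power_mono) auto
    also have "\<dots> = (1 - l) * (dist p' a')\<^sup>2 + l * (dist b' p')\<^sup>2 - l * (1 - l) * (dist a' b')\<^sup>2"
      unfolding dist_norm power2_norm_eq_inner z'_def
      by (simp add: inner_diff_left inner_diff_right inner_add_left inner_add_right
          inner_commute algebra_simps)
    finally show ?thesis unfolding tr by (simp add: dist_commute)
  qed
  then show ?thesis by blast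
qed

lemma quasilin_le:
  fixes a b c d :: "'a::cat0_space"
  shows "quasilin a b c d \<le> dist a b * dist c d"
proof (cases "a = b \<or> c = d")
  case True
  then show ?thesis by (auto simp: quasilin_def)
next
  case False
  define u v where "u = dist a b" and "v = dist c d"
  have uv: "u > 0" "v > 0" using False by (auto simp: u_def v_def)
  define l where "l = u / (u + v)"
  have l1: "1 - l = v / (u + v)" using uv by (simp add: l_def field_simps)
  have l: "0 < l" "l < 1" using uv by (auto simp: l_def)
  obtain z where z: "\<And>p. (dist p z)\<^sup>2 \<le>
      (1 - l) * (dist p a)\<^sup>2 + l * (dist p d)\<^sup>2 - l * (1 - l) * (dist a d)\<^sup>2"
    using cat0_convexity[of l a d] l by auto
  define B C where "B = dist b z" and "C = dist c z"
  have "dist b c \<le> B + C" unfolding B_def C_def by (metis dist_commute dist_triangle)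
  then have "(dist b c)\<^sup>2 \<le> (B + C)\<^sup>2" by (intro power_mono) auto
  also have "\<dots> \<le> B\<^sup>2 / l + C\<^sup>2 / (1 - l)"
  proof -
    have "B\<^sup>2 / l + C\<^sup>2 / (1 - l) - (B + C)\<^sup>2 = ((1 - l) * B - l * C)\<^sup>2 / (l * (1 - l))"
      using l by (simp add: field_simps) (simp add: power2_eq_square algebra_simps)
    also have "\<dots> \<ge> 0" using l by simp
    finally show ?thesis by simp
  qed
  also have "\<dots> \<le> ((1 - l) * u\<^sup>2 + l * (dist b d)\<^sup>2 - l * (1 - l) * (dist a d)\<^sup>2) / l
      + ((1 - l) * (dist a c)\<^sup>2 + l * v\<^sup>2 - l * (1 - l) * (dist a d)\<^sup>2) / (1 - l)"
    using z[of b] z[of c] l unfolding B_def C_def u_def v_def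
    by (intro add_mono divide_right_mono) (auto simp: dist_commute)
  also have "\<dots> = (1 - l) / l * u\<^sup>2 + l / (1 - l) * v\<^sup>2
      + (dist b d)\<^sup>2 + (dist a c)\<^sup>2 - (dist a d)\<^sup>2"
    using l by (simp add: field_simps)
  also have "(1 - l) / l * u\<^sup>2 = u * v"
    unfolding l1 using uv by (simp add: l_def power2_eq_square)
  also have "l / (1 - l) * v\<^sup>2 = u * v"
    unfolding l1 using uv by (simp add: l_def power2_eq_square)
  finally show ?thesis
    unfolding quasilin_def u_def v_def by simp
qed

lemma abs_quasilin_le:
  fixes a b c d :: "'a::cat0_space"
  shows "\<bar>quasilin a b c d\<bar> \<le> dist a b * dist c d"
proof -
  have "- quasilin a b c d = quasilin b a c d" by (simp add: quasilin_def field_simps)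
  then show ?thesis using quasilin_le[of a b c d] quasilin_le[of b a c d]
    by (simp add: dist_commute)
qed

lemma abs_dual_act_le:
  fixes s :: "'a::cat0_space dual_space"
  shows "\<exists>K\<ge>0. \<forall>x y. \<bar>dual_act s x y\<bar> \<le> K * dist x y"
proof (transfer, clarify)
  fix t :: real and a b :: 'a
  have "\<bar>t * quasilin a b x y\<bar> \<le> \<bar>t\<bar> * dist a b * dist x y" for x y
    using abs_quasilin_le[of a b x y]
    by (simp add: abs_mult mult.assoc mult_left_mono)
  then show "\<exists>K\<ge>0. \<forall>x y. \<bar>t * quasilin a b x y\<bar> \<le> K * dist x y"
    by (intro exI[of _ "\<bar>t\<bar> * dist a b"]) auto
qed

lemma abs_pairing_le:
  fixes f :: "'a::cat0_space linear_dual"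
  shows "\<exists>K\<ge>0. \<forall>x y. \<bar>pairing f x y\<bar> \<le> K * dist x y"
proof -
  obtain T \<alpha> where f: "\<And>x y. pairing f x y = (\<Sum>s\<in>T. \<alpha> s * dual_act s x y)"
    using pairing_exists[of f] by blast
  obtain K where K: "\<And>s. K s \<ge> (0::real)" "\<And>s x y. \<bar>dual_act s x y\<bar> \<le> K s * dist x (y::'a)"
    using abs_dual_act_le by metis
  have "\<bar>pairing f x y\<bar> \<le> (\<Sum>s\<in>T. \<bar>\<alpha> s\<bar> * K s) * dist x y" for x y
  proof -
    have "\<bar>pairing f x y\<bar> \<le> (\<Sum>s\<in>T. \<bar>\<alpha> s * dual_act s x y\<bar>)"
      unfolding f by (rule sum_abs)
    also have "\<dots> \<le> (\<Sum>s\<in>T. \<bar>\<alpha> s\<bar> * K s * dist x y)"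
      using K(2) by (intro sum_mono) (simp add: abs_mult mult.assoc mult_left_mono)
    finally show ?thesis by (simp add: sum_distrib_right)
  qed
  moreover have "(\<Sum>s\<in>T. \<bar>\<alpha> s\<bar> * K s) \<ge> 0" using K(1) by (intro sum_nonneg) auto
  ultimately show ?thesis by blast
qed

section \<open>The norm of the linear dual space\<close>

definition norm_quotients :: "'a::metric_space linear_dual \<Rightarrow> real set" where
  "norm_quotients f =
     {\<bar>pairing f a b - pairing f c d\<bar> / (dist a b + dist c d) | a b c d. (a, c) \<noteq> (b, d)}"

lemma bdd_above_norm_quotients:
  fixes f :: "'a::cat0_space linear_dual"
  shows "bdd_above (norm_quotients f)"
proof -
  obtain K where K: "\<And>x y. \<bar>pairing f x y\<bar> \<le> K * dist x y"
    using abs_pairing_le[of f] by blast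
  show ?thesis
  proof (rule bdd_aboveI[of _ K])
    fix q assume "q \<in> norm_quotients f"
    then obtain a b c d where q: "q = \<bar>pairing f a b - pairing f c d\<bar> / (dist a b + dist c d)"
      and ne: "(a, c) \<noteq> (b, d)"
      unfolding norm_quotients_def by blast
    have pos: "dist a b + dist c d > 0"
      using ne by (cases "a = b") (auto simp: add_pos_nonneg)
    have "\<bar>pairing f a b - pairing f c d\<bar> \<le> K * (dist a b + dist c d)"
      using K[of a b] K[of c d] by (simp add: distrib_left)
    then show "q \<le> K" using pos by (simp add: q pos_divide_le_eq)
  qed
qed

instantiation linear_dual :: (cat0_space) real_normed_vector
begin

text \<open>
  The inserted \<open>0\<close> only matters for a one-point space, where there are no quotients
  and the linear dual space is trivial.
\<close>

definition norm_linear_dual :: "'a linear_dual \<Rightarrow> real" where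
  "norm_linear_dual f = Sup (insert 0 (norm_quotients f))"

definition sgn_linear_dual :: "'a linear_dual \<Rightarrow> 'a linear_dual" where
  "sgn_linear_dual f = inverse (norm f) *\<^sub>R f"

definition dist_linear_dual :: "'a linear_dual \<Rightarrow> 'a linear_dual \<Rightarrow> real" where
  "dist_linear_dual f g = norm (f - g)"

definition uniformity_linear_dual :: "('a linear_dual \<times> 'a linear_dual) filter" where
  "uniformity_linear_dual = (INF e\<in>{0<..}. principal {(x, y). dist x y < e})"

definition open_linear_dual :: "'a linear_dual set \<Rightarrow> bool" where
  "open_linear_dual U = (\<forall>x\<in>U. eventually (\<lambda>(x', y). x' = x \<longrightarrow> y \<in> U) uniformity)"

instance
proof
  fix f g :: "'a linear_dual" and r :: real
  have norm_nonneg: "norm h \<ge> 0" for h :: "'a linear_dual"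
    unfolding norm_linear_dual_def
    by (rule cSup_upper) (auto simp: bdd_above_norm_quotients)
  have quot: "\<bar>pairing h a b - pairing h c d\<bar> \<le> norm h * (dist a b + dist c d)"
    for h :: "'a linear_dual" and a b c d
  proof (cases "(a, c) = (b, d)")
    case True
    obtain K where "\<And>x y. \<bar>pairing h x y\<bar> \<le> K * dist x y"
      using abs_pairing_le[of h] by blast
    from this[of a a] this[of c c] True show ?thesis by simp
  next
    case False
    then have "\<bar>pairing h a b - pairing h c d\<bar> / (dist a b + dist c d) \<in> norm_quotients h"
      unfolding norm_quotients_def by blast
    then have "\<bar>pairing h a b - pairing h c d\<bar> / (dist a b + dist c d) \<le> norm h"
      unfolding norm_linear_dual_def
      by (intro cSup_upper) (auto simp: bdd_above_norm_quotients)
    moreover have "dist a b + dist c d > 0"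
      using False by (cases "a = b") (auto simp: add_pos_nonneg)
    ultimately show ?thesis by (simp add: pos_divide_le_eq)
  qed
  have leI: "norm h \<le> K"
    if "K \<ge> 0" "\<And>a b c d. \<bar>pairing h a b - pairing h c d\<bar> \<le> K * (dist a b + dist c d)"
    for h :: "'a linear_dual" and K
    unfolding norm_linear_dual_def
  proof (rule cSup_least)
    fix q assume "q \<in> insert 0 (norm_quotients h)"
    then consider "q = 0" | a b c d where
      "q = \<bar>pairing h a b - pairing h c d\<bar> / (dist a b + dist c d)" "(a, c) \<noteq> (b, d)"
      unfolding norm_quotients_def by blast
    then show "q \<le> K"
    proof cases
      case 1
      then show ?thesis using that(1) by simp
    next
      case 2
      moreover have "dist a b + dist c d > 0"
        using 2 by (cases "a = b") (auto simp: add_pos_nonneg)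
      ultimately show ?thesis using that(2)[of a b c d] by (simp add: pos_divide_le_eq)
    qed
  qed simp
  show "(norm f = 0) = (f = 0)"
  proof
    assume "norm f = 0"
    then have eq: "pairing f a b = pairing f c d" for a b c d
      using quot[of f a b c d] by simp
    obtain K where K: "\<And>x y. \<bar>pairing f x y\<bar> \<le> K * dist x y"
      using abs_pairing_le[of f] by blast
    have "pairing f a b = 0" for a b
      using eq[of a b a a] K[of a a] by simp
    then show "f = 0" by (intro pairing_eqI) simp
  next
    assume "f = 0"
    then have "norm f \<le> 0" by (intro leI) auto
    then show "norm f = 0" using norm_nonneg[of f] by simp
  qed
  show "norm (f + g) \<le> norm f + norm g"
  proof (rule leI)
    fix a b c d
    show "\<bar>pairing (f + g) a b - pairing (f + g) c d\<bar> \<le> (norm f + norm g) * (dist a b + dist c d)"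
      using quot[of f a b c d] quot[of g a b c d] unfolding pairing_simps distrib_right[of "norm f"]
      by linarith
  qed (use norm_nonneg in auto)
  have scale: "norm (r *\<^sub>R h) \<le> \<bar>r\<bar> * norm h" for r and h :: "'a linear_dual"
  proof (rule leI)
    fix a b c d
    have "\<bar>pairing (r *\<^sub>R h) a b - pairing (r *\<^sub>R h) c d\<bar> = \<bar>r\<bar> * \<bar>pairing h a b - pairing h c d\<bar>"
      by (simp add: abs_mult[symmetric] right_diff_distrib)
    then show "\<bar>pairing (r *\<^sub>R h) a b - pairing (r *\<^sub>R h) c d\<bar> \<le> \<bar>r\<bar> * norm h * (dist a b + dist c d)"
      using quot[of h a b c d] by (simp add: mult.assoc mult_left_mono)
  qed (use norm_nonneg in auto)
  show "norm (r *\<^sub>R f) = \<bar>r\<bar> * norm f"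
  proof (cases "r = 0")
    case True
    then show ?thesis using scale[of 0 f] norm_nonneg[of "0 *\<^sub>R f"] by simp
  next
    case False
    have "\<bar>r\<bar> * norm f = \<bar>r\<bar> * norm (inverse r *\<^sub>R (r *\<^sub>R f))" using False by simp
    also have "\<dots> \<le> \<bar>r\<bar> * (\<bar>inverse r\<bar> * norm (r *\<^sub>R f))"
      by (intro mult_left_mono scale) auto
    also have "\<dots> = norm (r *\<^sub>R f)" using False by (simp add: abs_inverse)
    finally show ?thesis using scale[of r f] by simp
  qed
next
  fix f g :: "'a linear_dual" and U :: "'a linear_dual set"
  show "dist f g = norm (f - g)" by (rule dist_linear_dual_def)
  show "sgn f = f /\<^sub>R norm f" by (rule sgn_linear_dual_def)
  show "uniformity = (INF e\<in>{0<..}. principal {(x :: 'a linear_dual, y). dist x y < e})"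
    by (rule uniformity_linear_dual_def)
  show "open U = (\<forall>x\<in>U. \<forall>\<^sub>F (x', y) in uniformity. x' = x \<longrightarrow> y \<in> U)"
    by (rule open_linear_dual_def)
qed

end

section \<open>Monotone sets\<close>

definition monotonically_related ::
    "'a::metric_space \<times> 'a linear_dual \<Rightarrow> 'a \<times> 'a linear_dual \<Rightarrow> bool" where
  "monotonically_related = (\<lambda>(x, xd) (y, yd). pairing (xd - yd) y x \<ge> 0)"

definition monotone_set :: "('a::metric_space \<times> 'a linear_dual) set \<Rightarrow> bool" where
  "monotone_set M \<longleftrightarrow> (\<forall>p\<in>M. \<forall>q\<in>M. monotonically_related p q)"

definition maximal_monotone_set :: "('a::metric_space \<times> 'a linear_dual) set \<Rightarrow> bool" where
  "maximal_monotone_set M \<longleftrightarrow> monotone_set M \<and> \<not> (\<exists>N. monotone_set N \<and> M \<subset> N)"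

definition fiber :: "('a::metric_space \<times> 'a linear_dual) set \<Rightarrow> 'a \<Rightarrow> 'a linear_dual set" where
  "fiber M u = {ud. (u, ud) \<in> M}"

definition Dom :: "('a::metric_space \<times> 'a linear_dual) set \<Rightarrow> 'a set" where
  "Dom M = {x. \<exists>xd. (x, xd) \<in> M}"

section \<open>Modes of convergence\<close>

definition weakly_convergent_to :: "(nat \<Rightarrow> 'a::metric_space) \<Rightarrow> 'a \<Rightarrow> bool" where
  "weakly_convergent_to X x \<longleftrightarrow> (\<forall>y. (\<lambda>n. quasilin x (X n) x y) \<longlonglongrightarrow> 0)"

definition bw_convergent_to :: "(nat \<Rightarrow> 'a::metric_space) \<Rightarrow> 'a \<Rightarrow> bool" where
  "bw_convergent_to X x \<longleftrightarrow> bounded (range X) \<and> weakly_convergent_to X x"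

definition product_convergent_to ::
    "((nat \<Rightarrow> 'a) \<Rightarrow> 'a \<Rightarrow> bool) \<Rightarrow>
     (nat \<Rightarrow> 'a::cat0_space \<times> 'a linear_dual) \<Rightarrow> 'a \<times> 'a linear_dual \<Rightarrow> bool" where
  "product_convergent_to conv Z z \<longleftrightarrow>
     conv (\<lambda>n. fst (Z n)) (fst z) \<and> (\<lambda>n. norm (snd (Z n) - snd z)) \<longlonglongrightarrow> 0"

definition sequentially_closed :: "((nat \<Rightarrow> 'b) \<Rightarrow> 'b \<Rightarrow> bool) \<Rightarrow> 'b set \<Rightarrow> bool" where
  "sequentially_closed conv M \<longleftrightarrow> (\<forall>Z z. (\<forall>n. Z n \<in> M) \<and> conv Z z \<longrightarrow> z \<in> M)"

end

(* A point monotonically related to all of a maximal monotone set M lies in M, so membership in M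
   amounts to the inequalities 0 \<le> \<langle>x' - y', yx\<rangle> for (y, y') in M. These are affine in x', which gives
   convexity of the fibers, and they survive bw-times-norm limits: \<langle>x' - y', yx_n\<rangle> converges to
   \<langle>x' - y', yx\<rangle> because weak convergence of x_n to x passes through every element of the linear dual,
   and replacing x'_n by x' costs at most \<parallel>x'_n - x'\<parallel> d(y, x_n), which vanishes for bounded x_n. *)

theory Submission
  imports Defs
begin

lemma quasilin_commute: "quasilin a b c d = quasilin c d a b"
  by (simp add: quasilin_def dist_commute)

text \<open>The squared distances to \<open>y\<close> cancel. This additivity in the second pair
  passes to \<open>dual_act\<close> and \<open>pairing\<close>, and lets the base point of a pair be
  changed later.\<close>

lemma quasilin_chain: "quasilin a b x y + quasilin a b y z = quasilin a b x z"
  by (simp add: quasilin_def field_simps)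

lemma dual_act_chain: "dual_act s x y + dual_act s y z = dual_act s x z"
  by transfer (auto simp: quasilin_chain simp flip: distrib_left)

lemma pairing_chain: "pairing f x y + pairing f y z = pairing f x z"
proof -
  obtain T \<alpha> where f: "\<And>x y. pairing f x y = (\<Sum>s\<in>T. \<alpha> s * dual_act s x y)"
    using pairing_exists[of f] by blast
  show ?thesis
    unfolding f by (simp add: dual_act_chain flip: sum.distrib distrib_left)
qed

lemma pairing_self [simp]: "pairing f x x = 0"
  using pairing_chain[of f x x x] by simp

lemma pairing_swap: "pairing f y x = - pairing f x y"
  using pairing_chain[of f x y x] by simp

text \<open>Take the degenerate second pair \<open>(x, x)\<close> in the quotients defining the
  norm: the pairing vanishes there, so the quotient is the Lipschitz ratio of \<open>f\<close> at
  \<open>(x, y)\<close>.\<close>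

lemma abs_pairing_le_norm:
  fixes f :: "'a::cat0_space linear_dual"
  shows "\<bar>pairing f x y\<bar> \<le> norm f * dist x y"
proof (cases "x = y")
  case False
  then have "\<bar>pairing f x y - pairing f x x\<bar> / (dist x y + dist x x) \<in> norm_quotients f"
    unfolding norm_quotients_def by blast
  then have "\<bar>pairing f x y - pairing f x x\<bar> / (dist x y + dist x x) \<le> norm f"
    unfolding norm_linear_dual_def
    by (intro cSup_upper) (auto simp: bdd_above_norm_quotients)
  with False show ?thesis by (simp add: divide_le_eq)
qed simp

text \<open>Weak convergence only tests against pairs starting at the limit \<open>x\<close>; an
  arbitrary pair \<open>(a, b)\<close> is split as \<open>(x, b)\<close> minus
  \<open>(x, a)\<close>.\<close>

lemma weakly_convergent_to_quasilin:
  assumes "weakly_convergent_to X x"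
  shows "(\<lambda>n. quasilin a b x (X n)) \<longlonglongrightarrow> 0"
proof -
  have "quasilin a b x (X n) = quasilin x (X n) x b - quasilin x (X n) x a" for n
    using quasilin_chain[of x "X n" x a b] by (simp add: quasilin_commute[of a b])
  moreover have "(\<lambda>n. quasilin x (X n) x b - quasilin x (X n) x a) \<longlonglongrightarrow> 0 - 0"
    using assms unfolding weakly_convergent_to_def by (intro tendsto_diff) auto
  ultimately show ?thesis by simp
qed

lemma weakly_convergent_to_dual_act:
  assumes "weakly_convergent_to X x"
  shows "(\<lambda>n. dual_act s x (X n)) \<longlonglongrightarrow> 0"
  using assms
proof (transfer, clarify)
  fix X :: "nat \<Rightarrow> 'a" and x a b :: 'a and t :: real
  assume "weakly_convergent_to X x"
  then show "(\<lambda>n. t * quasilin a b x (X n)) \<longlonglongrightarrow> 0"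
    by (intro tendsto_mult_right_zero weakly_convergent_to_quasilin)
qed

text \<open>With base point \<open>x\<close> the pairing is a finite combination of null sequences;
  additivity along \<open>y\<close>, \<open>x\<close>, \<open>X n\<close> then moves the base point
  to \<open>y\<close>.\<close>

lemma weakly_convergent_to_pairing:
  assumes "weakly_convergent_to X x"
  shows "(\<lambda>n. pairing f y (X n)) \<longlonglongrightarrow> pairing f y x"
proof -
  obtain T \<alpha> where f: "\<And>x y. pairing f x y = (\<Sum>s\<in>T. \<alpha> s * dual_act s x y)"
    using pairing_exists[of f] by blast
  have "(\<lambda>n. pairing f x (X n)) \<longlonglongrightarrow> 0"
    unfolding f
    by (intro tendsto_null_sum tendsto_mult_right_zero weakly_convergent_to_dual_act assms)
  then have "(\<lambda>n. pairing f y x + pairing f x (X n)) \<longlonglongrightarrow> pairing f y x + 0"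
    by (intro tendsto_add tendsto_const)
  then show ?thesis by (simp add: pairing_chain)
qed

text \<open>By the Cauchy-Schwarz inequality the tested quantity is at most
  \<open>dist x (X n) * dist x y\<close>. This links the topological closedness of a set to its
  sequential bw-closedness.\<close>

lemma tendsto_imp_bw_convergent_to:
  fixes X :: "nat \<Rightarrow> 'a::cat0_space"
  assumes "X \<longlonglongrightarrow> x"
  shows "bw_convergent_to X x"
  unfolding bw_convergent_to_def weakly_convergent_to_def
proof (intro conjI allI)
  show "bounded (range X)" using assms by (rule convergent_imp_bounded)
next
  fix y
  have "(\<lambda>n. dist x (X n) * dist x y) \<longlonglongrightarrow> dist x x * dist x y"
    using assms by (intro tendsto_intros)
  then have "(\<lambda>n. dist x (X n) * dist x y) \<longlonglongrightarrow> 0"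
    by simp
  then show "(\<lambda>n. quasilin x (X n) x y) \<longlonglongrightarrow> 0"
    by (rule Lim_null_comparison[rotated]) (simp add: abs_quasilin_le)
qed

text \<open>Exchanging the two elements negates the functional and reverses the pair, so the sign
  changes twice.\<close>

lemma monotonically_related_commute:
  "monotonically_related p q \<longleftrightarrow> monotonically_related q p"
  using pairing_swap[of "snd p - snd q" "fst q" "fst p"]
  unfolding monotonically_related_def split_beta pairing_simps by linarith

text \<open>If \<open>p\<close> is related to all of \<open>M\<close>, then
  \<open>insert p M\<close> is still monotone, as \<open>p\<close> is related to itself by the
  vanishing of the pairing on the diagonal; maximality then forces \<open>p\<close> into
  \<open>M\<close>.\<close>

lemma maximal_monotone_set_mem_iff:
  assumes "maximal_monotone_set M"
  shows "p \<in> M \<longleftrightarrow> (\<forall>q\<in>M. monotonically_related p q)"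
proof
  show "\<forall>q\<in>M. monotonically_related p q" if "p \<in> M"
    using assms that by (auto simp: maximal_monotone_set_def monotone_set_def)
next
  assume p: "\<forall>q\<in>M. monotonically_related p q"
  moreover have "monotonically_related p p"
    by (simp add: monotonically_related_def split_beta)
  moreover have "\<forall>q\<in>M. monotonically_related q p"
    using p by (blast intro: monotonically_related_commute[THEN iffD1])
  ultimately have "monotone_set (insert p M)"
    using assms unfolding maximal_monotone_set_def monotone_set_def by blast
  then show "p \<in> M"
    using assms unfolding maximal_monotone_set_def by blast
qed

lemma convex_fiber:
  fixes M :: "('a::cat0_space \<times> 'a linear_dual) set"
  assumes M: "maximal_monotone_set M"
  shows "convex (fiber M u)"
proof (rule convexI)
  fix f g :: "'a linear_dual" and s t :: real
  assume f: "f \<in> fiber M u" and g: "g \<in> fiber M u"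
    and st: "0 \<le> s" "0 \<le> t" "s + t = 1"
  have "monotonically_related (u, s *\<^sub>R f + t *\<^sub>R g) (y, h)" if "(y, h) \<in> M" for y h
  proof -
    have "0 \<le> pairing (f - h) y u" "0 \<le> pairing (g - h) y u"
      using f g that M
      by (auto simp: fiber_def monotonically_related_def
          maximal_monotone_set_def monotone_set_def simp del: pairing_simps)
    then have "0 \<le> pairing (s *\<^sub>R (f - h) + t *\<^sub>R (g - h)) y u"
      using st by simp
    \<comment> \<open>Since \<open>s + t = 1\<close>, subtracting \<open>h\<close> commutes with the
      convex combination.\<close>
    also have "s *\<^sub>R (f - h) + t *\<^sub>R (g - h) = s *\<^sub>R f + t *\<^sub>R g - (s + t) *\<^sub>R h"
      by (simp add: algebra_simps)
    finally show ?thesis using st by (simp add: monotonically_related_def)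
  qed
  then show "s *\<^sub>R f + t *\<^sub>R g \<in> fiber M u"
    by (auto simp: fiber_def maximal_monotone_set_mem_iff[OF M, of "(u, s *\<^sub>R f + t *\<^sub>R g)"])
qed

lemma maximal_monotone_set_bw_closed:
  fixes M :: "('a::cat0_space \<times> 'a linear_dual) set"
  assumes M: "maximal_monotone_set M"
  shows "sequentially_closed (product_convergent_to bw_convergent_to) M"
  unfolding sequentially_closed_def
proof (intro allI impI, elim conjE)
  fix Z :: "nat \<Rightarrow> 'a \<times> 'a linear_dual" and z
  assume Z: "\<forall>n. Z n \<in> M" and conv: "product_convergent_to bw_convergent_to Z z"
  define X F where "X n = fst (Z n)" and "F n = snd (Z n)" for n
  define x f where "x = fst z" and "f = snd z"
  have bdd: "bounded (range X)" and weak: "weakly_convergent_to X x"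
    and F: "(\<lambda>n. norm (F n - f)) \<longlonglongrightarrow> 0"
    using conv by (simp_all add: product_convergent_to_def bw_convergent_to_def
        X_def[abs_def] F_def x_def f_def)
  have "monotonically_related (x, f) (y, g)" if yg: "(y, g) \<in> M" for y g
  proof -
    \<comment> \<open>\<open>B\<close> may depend on \<open>y\<close> but not on \<open>n\<close>,
      so the error \<open>norm (F n - f) * B\<close> tends to 0.\<close>
    obtain B where B: "\<And>n. dist y (X n) \<le> B"
      using bdd by (auto simp: bounded_any_center[where a = y])
    have "0 \<le> pairing (f - g) y (X n) + norm (F n - f) * B" for n
    proof -
      have "(X n, F n) \<in> M"
        using Z by (simp add: X_def F_def)
      then have "0 \<le> pairing (F n - g) y (X n)"
        using yg M by (auto simp: monotonically_related_def
            maximal_monotone_set_def monotone_set_def simp del: pairing_simps)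
      \<comment> \<open>The first summand has a fixed functional and is handled by weak convergence;
        the second has a functional that is small in norm.\<close>
      also have "\<dots> = pairing (f - g) y (X n) + pairing (F n - f) y (X n)"
        by simp
      also have "pairing (F n - f) y (X n) \<le> norm (F n - f) * B"
        using abs_pairing_le_norm[of "F n - f" y "X n"]
          mult_left_mono[OF B norm_ge_zero, of "F n - f" n] by linarith
      finally show ?thesis by simp
    qed
    moreover have "(\<lambda>n. pairing (f - g) y (X n) + norm (F n - f) * B)
        \<longlonglongrightarrow> pairing (f - g) y x + 0 * B"
      by (intro tendsto_intros weakly_convergent_to_pairing weak F)
    ultimately have "0 \<le> pairing (f - g) y x + 0 * B"
      by (intro LIMSEQ_le_const) auto
    then show ?thesis by (simp add: monotonically_related_def)
  qed
  then show "z \<in> M"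
    by (auto simp: maximal_monotone_set_mem_iff[OF M, of z] x_def f_def)
qed

text \<open>The product topology is metrizable, so sequences suffice, and a convergent sequence
  there is also bw-times-norm convergent.\<close>

lemma closed_maximal_monotone_set:
  fixes M :: "('a::cat0_space \<times> 'a linear_dual) set"
  assumes M: "maximal_monotone_set M"
  shows "closed M"
  unfolding closed_sequential_limits
proof (intro allI impI, elim conjE)
  fix Z :: "nat \<Rightarrow> 'a \<times> 'a linear_dual" and z
  assume Z: "\<forall>n. Z n \<in> M" and lim: "Z \<longlonglongrightarrow> z"
  have "bw_convergent_to (\<lambda>n. fst (Z n)) (fst z)"
    using lim by (intro tendsto_imp_bw_convergent_to tendsto_fst)
  moreover have "(\<lambda>n. norm (snd (Z n) - snd z)) \<longlonglongrightarrow> 0"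
    using tendsto_snd[OF lim] by (intro tendsto_norm_zero) (simp add: LIM_zero_iff)
  ultimately have "product_convergent_to bw_convergent_to Z z"
    by (simp add: product_convergent_to_def)
  with Z maximal_monotone_set_bw_closed[OF M] show "z \<in> M"
    unfolding sequentially_closed_def by blast
qed

text \<open>The fiber is the preimage of \<open>M\<close> under the continuous embedding
  \<open>Pair u\<close>.\<close>

lemma closed_fiber:
  fixes M :: "('a::cat0_space \<times> 'a linear_dual) set"
  assumes "closed M"
  shows "closed (fiber M u)"
proof -
  have "fiber M u = Pair u -` M" by (auto simp: fiber_def)
  then show ?thesis
    using assms by (simp add: closed_vimage continuous_on_Pair)
qed

theorem proposition3p19:
  fixes M :: "('a::hadamard_space \<times> 'a linear_dual) set"
  assumes "maximal_monotone_set M"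
  shows "(\<forall>u. closed (fiber M u) \<and> convex (fiber M u))
    \<and> (sequentially_closed (product_convergent_to bw_convergent_to) M \<and> closed M)
    \<and> (bounded (Dom M) \<longrightarrow>
         sequentially_closed (product_convergent_to weakly_convergent_to) M)"
proof (intro conjI allI impI)
  show "closed M" using assms by (rule closed_maximal_monotone_set)
  then show "closed (fiber M u)" for u by (rule closed_fiber)
  show "convex (fiber M u)" for u using assms by (rule convex_fiber)
  show bw: "sequentially_closed (product_convergent_to bw_convergent_to) M"
    using assms by (rule maximal_monotone_set_bw_closed)
  assume bdd: "bounded (Dom M)"
  show "sequentially_closed (product_convergent_to weakly_convergent_to) M"
    unfolding sequentially_closed_def
  proof (intro allI impI, elim conjE)
    fix Z :: "nat \<Rightarrow> 'a \<times> 'a linear_dual" and z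
    assume Z: "\<forall>n. Z n \<in> M" and conv: "product_convergent_to weakly_convergent_to Z z"
    \<comment> \<open>The bounded domain contains all first components, so weak convergence of the
      sequence becomes bw-convergence and the preceding closedness applies.\<close>
    have "fst (Z n) \<in> Dom M" for n
      using Z[rule_format, of n] unfolding Dom_def by (cases "Z n") auto
    then have "bounded (range (\<lambda>n. fst (Z n)))"
      by (intro bounded_subset[OF bdd]) auto
    with conv have "product_convergent_to bw_convergent_to Z z"
      by (simp add: product_convergent_to_def bw_convergent_to_def)
    with Z bw show "z \<in> M"
      unfolding sequentially_closed_def by blast
  qed
qed

end
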